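(* Let $X^{\mathrm{in}}\subset\mathbb R^d$ be a nonempty polytope with $X^{\mathrm{in}}\neq\{0\}$, let $A$ be a real $d\times d$ matrix with spectral radius $\rho(A)<1$ admitting a decomposition $A=UDU^{-1}$ with $U$ a non-singular complex matrix and $D$ a complex diagonal matrix, let $Q$ be a real symmetric $d\times d$ matrix with $\lambda_{\max}(Q)\neq 0$, and let $q\in\mathbb R^d$. Let $\nu=(\nu_k)_{k\in\mathbb N}$, $\mathrm{Pos}^{>}_\nu$, $\operatorname{Argmax}(\nu)$, $\mathbf K^{\geqslant}_\nu$ and $\mathbf K^{\rm diag}_\nu$ be as defined in the context. Then: 1. For $j,k\in\mathrm{Pos}^{>}_\nu$, if $\nu_k\le\nu_j$ then $\mathbf K^{\rm diag}_\nu(j)\le\mathbf K^{\rm diag}_\nu(k)$. 2. Let $j\in\mathrm{Pos}^{>}_\nu$. If $j\notin\operatorname{Argmax}(\nu)$, then $\mathbf K^{\geqslant}_\nu\le\mathbf K^{\rm diag}_\nu(j)$; otherwise $\mathbf K^{\geqslant}_\nu\le\max\{j,\mathbf K^{\rm diag}_\nu(j)\}$.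
   Context: $\mathbb N=\{0,1,2,\dots\}$. A polytope is the convex hull of finitely many points. $U^*$ is the conjugate transpose; $\lambda_{\max}(B)$ is the greatest eigenvalue of a Hermitian matrix $B$. For $k\in\mathbb N$, $\nu_k=\sup_{x\in X^{\mathrm{in}}}\left(x^\intercal (A^k)^\intercal QA^kx+q^\intercal A^kx\right)$; since $\rho(A)<1$, $\nu_k\to0$. $\mathrm{Pos}^{>}_\nu=\{k\in\mathbb N\mid\nu_k>0\}$. $S_\nu^{n,m}=\sup_{n\le k\le m}\nu_k$ and $S_\nu^{n,\infty}=\sup_{k\ge n}\nu_k$. $\operatorname{Argmax}(\nu)=\{k\in\mathbb N\mid\nu_k=S_\nu^{0,\infty}\}$. $\mathbf K^{\geqslant}_\nu=\inf\{k\in\mathbb N\mid S_\nu^{0,k}\ge S_\nu^{k+1,\infty}\}$ (with $\inf\emptyset=+\infty$). For a Hermitian matrix $B$, $\mu(B)=\sup_{x\in X^{\mathrm{in}}}x^\intercal Bx$. $V_{\rm diag}=\dfrac{\|U^*q\|_2}{2\sqrt{|\lambda_{\max}(U^*QU)|}}$ (here $\lambda_{\max}(U^*QU)\neq0$ because $\lambda_{\max}(Q)\neq0$). For $j\in\mathrm{Pos}^{>}_\nu$, $$\mathbf K^{\rm diag}_\nu(j)=\left\lfloor\frac{\ln\left(\left(\sqrt{\nu_j+V_{\rm diag}^2}-V_{\rm diag}\right)\left(\sqrt{|\lambda_{\max}(U^*QU)|\,\mu\left((UU^* )^{-1}\right)}\right)^{-1}\right)}{\ln(\rho(A))}\right\rfloor+1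 .$$ In the degenerate case $\rho(A)=0$ the convention is $\ln 0=-\infty$ and $c/(-\infty)=0$ for real $c$, so that $\mathbf K^{\rm diag}_\nu(j)=1$. *)

theory Defs
  imports "HOL-Analysis.Analysis"
begin

text \<open>Power with respect to the matrix product; \<open>(^)\<close> on the vector type is not that power.\<close>

primrec matpow :: "'a::semiring_1^'n^'n \<Rightarrow> nat \<Rightarrow> 'a^'n^'n" where
  "matpow A 0 = mat 1"
| "matpow A (Suc k) = A ** matpow A k"

definition cvec :: "real^'n \<Rightarrow> complex^'n" where
  "cvec x = (\<chi> i. complex_of_real (x $ i))"

definition cmat :: "real^'n^'m \<Rightarrow> complex^'n^'m" where
  "cmat A = (\<chi> i j. complex_of_real (A $ i $ j))"

definition conj_transpose :: "complex^'n^'m \<Rightarrow> complex^'m^'n" where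
  "conj_transpose U = (\<chi> i j. cnj (U $ j $ i))"

definition diagonal_matrix :: "'a::zero^'n^'n \<Rightarrow> bool" where
  "diagonal_matrix D \<longleftrightarrow> (\<forall>i j. i \<noteq> j \<longrightarrow> D $ i $ j = 0)"

definition is_eigenvalue :: "complex^'n^'n \<Rightarrow> complex \<Rightarrow> bool" where
  "is_eigenvalue B c \<longleftrightarrow> (\<exists>v. v \<noteq> 0 \<and> B *v v = c *s v)"

definition spectral_radius :: "real^'n^'n \<Rightarrow> real" where
  "spectral_radius A = Max {cmod c | c. is_eigenvalue (cmat A) c}"

text \<open>Only used for Hermitian \<open>B\<close>, all of whose eigenvalues are real.\<close>

definition lambda_max :: "complex^'n^'n \<Rightarrow> real" where
  "lambda_max B = Max {r. is_eigenvalue B (complex_of_real r)}"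

text \<open>Only used for Hermitian \<open>B\<close>, for which the sum is real, so that \<open>Re\<close> is just a coercion.\<close>

definition mu :: "(real^'n) set \<Rightarrow> complex^'n^'n \<Rightarrow> real" where
  "mu X B = (SUP x\<in>X. Re (\<Sum>i\<in>UNIV. cvec x $ i * (B *v cvec x) $ i))"

definition nu :: "(real^'n) set \<Rightarrow> real^'n^'n \<Rightarrow> real^'n^'n \<Rightarrow> real^'n \<Rightarrow> nat \<Rightarrow> real" where
  "nu X A Q q k =
    (SUP x\<in>X. x \<bullet> ((transpose (matpow A k) ** Q ** matpow A k) *v x) + q \<bullet> (matpow A k *v x))"

text \<open>The suprema below are real ones, meaningful for sequences that are bounded above
  (in particular for convergent ones).\<close>

definition sup_between :: "(nat \<Rightarrow> real) \<Rightarrow> nat \<Rightarrow> nat \<Rightarrow> real" where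
  "sup_between \<nu> n m = (SUP k\<in>{n..m}. \<nu> k)"

definition sup_from :: "(nat \<Rightarrow> real) \<Rightarrow> nat \<Rightarrow> real" where
  "sup_from \<nu> n = (SUP k\<in>{n..}. \<nu> k)"

definition Pos :: "(nat \<Rightarrow> real) \<Rightarrow> nat set" where
  "Pos \<nu> = {k. \<nu> k > 0}"

definition Argmax :: "(nat \<Rightarrow> real) \<Rightarrow> nat set" where
  "Argmax \<nu> = {k. \<nu> k = sup_from \<nu> 0}"

text \<open>Extended-real valued: the infimum of the empty set is \<open>\<infinity>\<close>.\<close>

definition K_geq :: "(nat \<Rightarrow> real) \<Rightarrow> ereal" where
  "K_geq \<nu> = (INF k\<in>{k. sup_between \<nu> 0 k \<ge> sup_from \<nu> (k + 1)}. ereal (real k))"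

definition V_diag :: "real^'n^'n \<Rightarrow> real^'n \<Rightarrow> complex^'n^'n \<Rightarrow> real" where
  "V_diag Q q U = norm (conj_transpose U *v cvec q)
    / (2 * sqrt \<bar>lambda_max (conj_transpose U ** cmat Q ** U)\<bar>)"

text \<open>The first case is the convention \<open>ln 0 = -\<infinity>\<close> and \<open>c / (-\<infinity>) = 0\<close>.\<close>

definition K_diag ::
  "(real^'n) set \<Rightarrow> real^'n^'n \<Rightarrow> real^'n^'n \<Rightarrow> real^'n \<Rightarrow> complex^'n^'n \<Rightarrow> nat \<Rightarrow> int" where
  "K_diag X A Q q U j =
    (if spectral_radius A = 0 then 1
     else \<lfloor>ln ((sqrt (nu X A Q q j + (V_diag Q q U)\<^sup>2) - V_diag Q q U)
              * inverse (sqrt (\<bar>lambda_max (conj_transpose U ** cmat Q ** U)\<bar>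
                               * mu X (matrix_inv (U ** conj_transpose U)))))
           / ln (spectral_radius A)\<rfloor> + 1)"

end

theory Submission
  imports Defs
begin

text \<open>
  In the coordinates \<open>z = U\<inverse> A\<^sup>k x\<close> the matrix acts as \<open>D\<close>, whose diagonal entries are the
  eigenvalues of \<open>A\<close>. Hence \<open>\<parallel>z\<parallel> \<le> \<rho>\<^sup>k \<parallel>U\<inverse> x\<parallel>\<close> for the spectral radius \<open>\<rho>\<close>
  (\<open>norm_orbit_le\<close>), and \<open>\<parallel>U\<inverse> x\<parallel>\<^sup>2\<close> is the quadratic form of \<open>(U U\<^sup>*)\<inverse>\<close> at \<open>x\<close>, so it is at
  most the supremum \<open>\<mu>\<close> of that form. Bounding the quadratic part by the Rayleigh quotient of
  \<open>U\<^sup>* Q U\<close> and the linear part by Cauchy--Schwarz gives, with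
  \<open>\<Lambda> = \<bar>\<lambda>\<^sub>m\<^sub>a\<^sub>x(U\<^sup>* Q U)\<bar>\<close>, \<open>S = sqrt (\<Lambda> \<mu>)\<close> and \<open>V = V_diag Q q U\<close>,
  \<open>\<nu>\<^sub>k \<le> (\<rho>\<^sup>k S)\<^sup>2 + 2 V (\<rho>\<^sup>k S)\<close>
  (\<open>nu_le\<close>). The right-hand side is increasing in \<open>t = \<rho>\<^sup>k S \<ge> 0\<close> and reaches \<open>\<nu>\<^sub>j > 0\<close> at
  \<open>t = sqrt (\<nu>\<^sub>j + V\<^sup>2) - V > 0\<close>. For \<open>\<rho> > 0\<close> the index \<open>K_diag\<close> at \<open>j\<close> is the first integer exceeding the
  solution \<open>k\<close> of \<open>\<rho>\<^sup>k S = sqrt (\<nu>\<^sub>j + V\<^sup>2) - V\<close>, so \<open>\<nu>\<^sub>k < \<nu>\<^sub>j\<close> for every \<open>k\<close> from that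
  index on; for \<open>\<rho> = 0\<close> the index is \<open>1\<close> and the bound vanishes from there on.

  Both claims follow. The root \<open>sqrt (\<nu>\<^sub>j + V\<^sup>2) - V\<close> grows with \<open>\<nu>\<^sub>j\<close> while \<open>ln \<rho> < 0\<close>, which is the
  monotonicity. For the bound, \<open>k = j\<close> shows that \<open>j\<close> itself lies strictly below its index
  (otherwise \<open>\<nu>\<^sub>j < \<nu>\<^sub>j\<close>), so the supremum up to the index is at least \<open>\<nu>\<^sub>j\<close>, which dominates the
  tail.

  Dividing by \<open>S\<close> and by \<open>sqrt \<Lambda>\<close> requires \<open>\<mu> > 0\<close>, which holds since \<open>X\<close> has a nonzero point,
  and \<open>\<Lambda> > 0\<close>, which is a weak form of Sylvester's law of inertia
  (\<open>lambda_max_congruence_nonzero\<close>).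
\<close>

section \<open>Extremal eigenvalues of self-adjoint operators\<close>

text \<open>The first-order condition at a minimum with value \<open>0\<close> at \<open>t = 0\<close>, in the form in which the
  proof that a maximizer of the Rayleigh quotient is an eigenvector needs it.\<close>

lemma linear_coefficient_zero:
  fixes a b :: real
  assumes "\<And>t. 0 \<le> t * a + t\<^sup>2 * b"
  shows "a = 0"
proof (rule ccontr)
  assume "a \<noteq> 0"
  \<comment> \<open>Any \<open>c > max 0 b\<close> makes the quadratic negative at \<open>- a / c\<close>.\<close>
  define c where "c = \<bar>b\<bar> + 1"
  have c: "c > 0" "b < c" by (auto simp: c_def)
  have "0 \<le> (- a / c) * a + (- a / c)\<^sup>2 * b" by (rule assms)
  also have "\<dots> = (a / c)\<^sup>2 * (b - c)"
    using c by (simp add: field_simps power2_eq_square)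
  also have "\<dots> < 0"
    using \<open>a \<noteq> 0\<close> c by (intro mult_pos_neg) auto
  finally show False by simp
qed

text \<open>The form \<open>x \<bullet> f x\<close> attains its maximum \<open>m\<close> over the compact unit sphere, say at \<open>v\<close>. Then
  \<open>m \<parallel>x\<parallel>\<^sup>2 - x \<bullet> f x\<close> is nonnegative and vanishes at \<open>v\<close>, so its derivative at \<open>v\<close>
  vanishes in every direction \<open>w\<close>, which says \<open>f v = m v\<close>.\<close>

lemma selfadjoint_top_eigenvector:
  fixes f :: "'a::euclidean_space \<Rightarrow> 'a"
  assumes lin: "linear f" and sa: "\<And>x y. f x \<bullet> y = x \<bullet> f y"
  obtains v m where "v \<noteq> 0" "f v = m *\<^sub>R v" "\<And>x. x \<bullet> f x \<le> m * (norm x)\<^sup>2"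
proof -
  have "continuous_on (sphere 0 1) (\<lambda>x. x \<bullet> f x)"
    using lin by (intro continuous_intros linear_continuous_on) (simp add: linear_conv_bounded_linear)
  then obtain v where v: "norm v = 1" and max: "\<And>x. norm x = 1 \<Longrightarrow> x \<bullet> f x \<le> v \<bullet> f v"
    using continuous_attains_sup[of "sphere (0::'a) 1" "\<lambda>x. x \<bullet> f x"] by auto
  define m where "m = v \<bullet> f v"
  have bound: "x \<bullet> f x \<le> m * (norm x)\<^sup>2" for x
  proof (cases "x = 0")
    case False
    define u where "u = x /\<^sub>R norm x"
    have x: "x = norm x *\<^sub>R u" using False by (simp add: u_def)
    have "u \<bullet> f u \<le> m"
      unfolding m_def using False by (intro max) (simp add: u_def)
    moreover have "x \<bullet> f x = (norm x)\<^sup>2 * (u \<bullet> f u)"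
      by (subst (1 2) x) (simp add: linear_cmul[OF lin] power2_eq_square)
    ultimately show ?thesis
      by (metis mult.commute mult_left_mono zero_le_power2)
  qed (simp add: linear_0[OF lin])
  have "(m *\<^sub>R v - f v) \<bullet> w = 0" for w
  proof -
    have "0 \<le> t * (2 * ((m *\<^sub>R v - f v) \<bullet> w)) + t\<^sup>2 * (m * (norm w)\<^sup>2 - w \<bullet> f w)" for t
    proof -
      have "w \<bullet> f v = f v \<bullet> w" "v \<bullet> f w = f v \<bullet> w"
        using sa by (simp_all add: inner_commute)
      then have "(v + t *\<^sub>R w) \<bullet> f (v + t *\<^sub>R w) = m + 2 * t * (f v \<bullet> w) + t\<^sup>2 * (w \<bullet> f w)"
        unfolding linear_add[OF lin] linear_cmul[OF lin] m_def
        by (simp add: inner_simps power2_eq_square algebra_simps)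
      moreover have "(norm (v + t *\<^sub>R w))\<^sup>2 = 1 + 2 * t * (v \<bullet> w) + t\<^sup>2 * (norm w)\<^sup>2"
        unfolding power2_norm_eq_inner
        using v by (simp add: inner_simps inner_commute[of w v] norm_eq_1
            power2_eq_square algebra_simps)
      ultimately show ?thesis
        using bound[of "v + t *\<^sub>R w"] by (simp add: inner_simps algebra_simps)
    qed
    from linear_coefficient_zero[OF this] show ?thesis by simp
  qed
  then have "f v = m *\<^sub>R v" by (metis inner_eq_zero_iff eq_iff_diff_eq_0)
  moreover have "v \<noteq> 0" using v by auto
  ultimately show ?thesis using that bound by blast
qed

text \<open>Eigenvectors for distinct eigenvalues are orthogonal, hence independent.\<close>

lemma selfadjoint_finite_eigenvalues:
  fixes f :: "'a::euclidean_space \<Rightarrow> 'a"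
  assumes sa: "\<And>x y. f x \<bullet> y = x \<bullet> f y"
  shows "finite {r. \<exists>v. v \<noteq> 0 \<and> f v = r *\<^sub>R v}" (is "finite ?E")
proof -
  have "\<forall>r\<in>?E. \<exists>v. v \<noteq> 0 \<and> f v = r *\<^sub>R v" by simp
  then obtain v where v: "\<And>r. r \<in> ?E \<Longrightarrow> v r \<noteq> 0 \<and> f (v r) = r *\<^sub>R v r"
    unfolding bchoice_iff by blast
  have orth: "v r \<bullet> v s = 0" if "r \<in> ?E" "s \<in> ?E" "r \<noteq> s" for r s
    using sa[of "v r" "v s"] v[OF that(1)] v[OF that(2)] that(3) by simp
  have "pairwise orthogonal (v ` ?E)"
    unfolding pairwise_def orthogonal_def using orth by blast
  moreover have "0 \<notin> v ` ?E" using v by (metis (no_types, lifting) image_iff)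
  ultimately have "independent (v ` ?E)" by (rule pairwise_orthogonal_independent)
  then have "finite (v ` ?E)" by (rule independent_imp_finite)
  moreover have "inj_on v ?E"
  proof (rule inj_onI)
    fix r s assume rs: "r \<in> ?E" "s \<in> ?E" "v r = v s"
    show "r = s"
    proof (rule ccontr)
      assume "r \<noteq> s"
      then have "v r \<bullet> v r = 0" using orth[OF rs(1,2)] rs(3) by simp
      then show False using v[OF rs(1)] by simp
    qed
  qed
  ultimately show ?thesis by (rule finite_imageD)
qed

section \<open>Hermitian matrices\<close>

text \<open>Here \<open>\<complex>\<^sup>n\<close> is treated as a real Euclidean space, with the real part of the Hermitian
  product as its inner product. Hermitian matrices are then self-adjoint real-linear operators, and
  as their eigenvalues are real, nothing of their spectrum is lost.\<close>

lemma inner_conj_transpose_left: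
  "(conj_transpose B *v z) \<bullet> w = z \<bullet> (B *v w)"
proof -
  have 1: "(cnj b * a) \<bullet> c = a \<bullet> (b * c)" for a b c :: complex
    by (simp add: inner_complex_def algebra_simps)
  have "(conj_transpose B *v z) \<bullet> w = (\<Sum>i\<in>UNIV. \<Sum>j\<in>UNIV. z $ j \<bullet> (B $ j $ i * w $ i))"
    by (simp add: inner_vec_def matrix_vector_mult_def conj_transpose_def inner_sum_left 1)
  also have "\<dots> = z \<bullet> (B *v w)"
    by (subst sum.swap) (simp add: inner_vec_def matrix_vector_mult_def inner_sum_right)
  finally show ?thesis .
qed

lemma conj_transpose_mult: "conj_transpose (B ** C) = conj_transpose C ** conj_transpose B"
  by (simp add: conj_transpose_def matrix_matrix_mult_def vec_eq_iff mult.commute)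

lemma conj_transpose_conj_transpose [simp]: "conj_transpose (conj_transpose B) = B"
  by (simp add: conj_transpose_def vec_eq_iff)

lemma conj_transpose_mat_1 [simp]: "conj_transpose (mat 1) = mat 1"
  by (simp add: conj_transpose_def vec_eq_iff mat_def)

lemma is_eigenvalue_of_real:
  fixes B :: "complex^'n^'n"
  shows
  "is_eigenvalue B (complex_of_real r) \<longleftrightarrow> (\<exists>v. v \<noteq> 0 \<and> B *v v = r *\<^sub>R v)"
proof -
  have "complex_of_real r *s v = r *\<^sub>R v" for v :: "complex^'n"
    by (simp add: vec_eq_iff complex_eq_iff)
  then show ?thesis by (simp add: is_eigenvalue_def)
qed

text \<open>Since \<open>lambda_max\<close> is a \<open>Max\<close>, it means something only once the set of real eigenvalues is
  known to be finite and nonempty; the previous section provides both.\<close>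

lemma
  assumes "conj_transpose B = B"
  shows lambda_max_eigenvalue: "is_eigenvalue B (complex_of_real (lambda_max B))"
    and eigenvalue_le_lambda_max: "is_eigenvalue B (complex_of_real r) \<Longrightarrow> r \<le> lambda_max B"
    and rayleigh_le_lambda_max: "z \<bullet> (B *v z) \<le> lambda_max B * (norm z)\<^sup>2"
proof -
  have sa: "(B *v x) \<bullet> y = x \<bullet> (B *v y)" for x y
    using inner_conj_transpose_left[of B x y] assms by simp
  have lin: "linear ((*v) B)"
    by (rule bounded_linear.linear[OF matrix_vector_mul_bounded_linear])
  define E where "E = {r. is_eigenvalue B (complex_of_real r)}"
  have E: "E = {r. \<exists>v. v \<noteq> 0 \<and> B *v v = r *\<^sub>R v}"
    by (simp add: E_def is_eigenvalue_of_real)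
  have fin: "finite E" unfolding E by (rule selfadjoint_finite_eigenvalues) (rule sa)
  obtain v m where v: "v \<noteq> 0" "B *v v = m *\<^sub>R v" "\<And>x. x \<bullet> (B *v x) \<le> m * (norm x)\<^sup>2"
    using selfadjoint_top_eigenvector[OF lin sa] by blast
  have m: "m \<in> E" using v unfolding E by auto
  have L: "lambda_max B = Max E" by (simp add: lambda_max_def E_def)
  have "Max E \<in> E" using fin m by (intro Max_in) auto
  then show "is_eigenvalue B (complex_of_real (lambda_max B))" unfolding L by (simp add: E_def)
  show "r \<le> lambda_max B" if "is_eigenvalue B (complex_of_real r)"
    unfolding L using fin that by (intro Max_ge) (auto simp: E_def)
  have "m \<le> Max E" using fin m by simp
  then have "m * (norm z)\<^sup>2 \<le> lambda_max B * (norm z)\<^sup>2"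
    unfolding L by (intro mult_right_mono) auto
  with v(3)[of z] show "z \<bullet> (B *v z) \<le> lambda_max B * (norm z)\<^sup>2" by linarith
qed

lemma
  assumes "invertible B"
  shows mult_matrix_inv: "B ** matrix_inv B = mat 1"
    and matrix_inv_mult: "matrix_inv B ** B = mat 1"
proof -
  from assms have "\<exists>C. B ** C = mat 1 \<and> C ** B = mat 1" by (simp add: invertible_def)
  then have "B ** matrix_inv B = mat 1 \<and> matrix_inv B ** B = mat 1"
    unfolding matrix_inv_def by (rule someI_ex)
  then show "B ** matrix_inv B = mat 1" and "matrix_inv B ** B = mat 1" by auto
qed

lemma matrix_inv_cancel:
  assumes "invertible U"
  shows "matrix_inv U *v (U *v z) = z" and "U *v (matrix_inv U *v w) = w"
  using assms by (simp_all add: matrix_vector_mul_assoc mult_matrix_inv matrix_inv_mult)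

text \<open>If \<open>\<lambda>\<^sub>m\<^sub>a\<^sub>x(U\<^sup>* H U) = 0\<close>, then \<open>U\<^sup>* H U\<close> is negative semidefinite and singular. Both
  properties pass to \<open>H\<close> because \<open>U\<close> is invertible, and together they force \<open>\<lambda>\<^sub>m\<^sub>a\<^sub>x(H) = 0\<close>.\<close>

lemma lambda_max_congruence_nonzero:
  assumes H: "conj_transpose H = H" and U: "invertible U" and nz: "lambda_max H \<noteq> 0"
  shows "lambda_max (conj_transpose U ** H ** U) \<noteq> 0"
proof
  let ?B = "conj_transpose U ** H ** U"
  have B: "conj_transpose ?B = ?B"
    using H by (simp add: conj_transpose_mult matrix_mul_assoc)
  assume 0: "lambda_max ?B = 0"
  have form: "z \<bullet> (?B *v z) = (U *v z) \<bullet> (H *v (U *v z))" for z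
    by (metis conj_transpose_conj_transpose inner_conj_transpose_left matrix_vector_mul_assoc)
  have neg: "w \<bullet> (H *v w) \<le> 0" for w
    using rayleigh_le_lambda_max[OF B, of "matrix_inv U *v w"] U
    by (simp add: 0 form matrix_inv_cancel)
  obtain z where z: "z \<noteq> 0" "?B *v z = 0"
    using lambda_max_eigenvalue[OF B] unfolding 0 is_eigenvalue_of_real by auto
  have "conj_transpose U *v (H *v (U *v z)) = 0"
    using z(2) by (simp add: matrix_vector_mul_assoc matrix_mul_assoc)
  then have "(H *v (U *v z)) \<bullet> (U *v y) = 0" for y
    by (metis inner_conj_transpose_left inner_zero_left)
  then have "H *v (U *v z) = 0"
    by (metis U inner_eq_zero_iff matrix_inv_cancel(2))
  moreover have "U *v z \<noteq> 0"
    using z(1) U by (metis matrix_inv_cancel(1) matrix_vector_mult_0_right)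
  ultimately have "is_eigenvalue H (complex_of_real 0)"
    unfolding is_eigenvalue_of_real by auto
  then have "0 \<le> lambda_max H" by (rule eigenvalue_le_lambda_max[OF H])
  obtain v where v: "v \<noteq> 0" "H *v v = lambda_max H *\<^sub>R v"
    using lambda_max_eigenvalue[OF H] unfolding is_eigenvalue_of_real by auto
  have "lambda_max H * (norm v)\<^sup>2 \<le> 0"
    using neg[of v] v(2) by (simp add: dot_square_norm)
  then have "lambda_max H \<le> 0" using v(1) by (simp add: mult_le_0_iff)
  with \<open>0 \<le> lambda_max H\<close> nz show False by simp
qed

section \<open>Real vectors and matrices inside the complex ones\<close>

lemma cvec_eq_0_iff [simp]: "cvec x = 0 \<longleftrightarrow> x = 0"
  by (simp add: cvec_def vec_eq_iff)

lemma inner_cvec [simp]: "cvec x \<bullet> cvec y = x \<bullet> y"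
  by (simp add: cvec_def inner_vec_def inner_complex_def)

lemma cmat_mult_cvec: "cmat B *v cvec x = cvec (B *v x)"
  by (simp add: cmat_def cvec_def matrix_vector_mult_def vec_eq_iff)

lemma conj_transpose_cmat: "conj_transpose (cmat B) = cmat (transpose B)"
  by (simp add: conj_transpose_def cmat_def transpose_def vec_eq_iff)

lemma bounded_linear_cvec: "bounded_linear cvec"
  unfolding linear_conv_bounded_linear[symmetric]
  by (intro linearI) (simp_all add: cvec_def vec_eq_iff complex_eq_iff)

lemma matrix_inv_mult_conj_transpose:
  assumes "invertible U"
  shows "matrix_inv (U ** conj_transpose U) = conj_transpose (matrix_inv U) ** matrix_inv U"
proof -
  let ?V = "matrix_inv U"
  have V: "U ** ?V = mat 1" "?V ** U = mat 1"
    using assms by (simp_all add: mult_matrix_inv matrix_inv_mult)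
  have V': "conj_transpose ?V ** conj_transpose U = mat 1" "conj_transpose U ** conj_transpose ?V = mat 1"
    by (metis V conj_transpose_mult conj_transpose_mat_1)+
  have 1: "(U ** conj_transpose U) ** (conj_transpose ?V ** ?V) = mat 1"
    by (metis V(1) V'(2) matrix_mul_assoc matrix_mul_rid)
  have 2: "(conj_transpose ?V ** ?V) ** (U ** conj_transpose U) = mat 1"
    by (metis V(2) V'(1) matrix_mul_assoc matrix_mul_rid)
  have "invertible (U ** conj_transpose U)" using 1 2 unfolding invertible_def by blast
  then have "matrix_inv (U ** conj_transpose U) ** (U ** conj_transpose U) = mat 1"
    by (rule matrix_inv_mult)
  then show ?thesis by (metis 1 matrix_mul_assoc matrix_mul_lid matrix_mul_rid)
qed

text \<open>This is what ties \<open>\<mu>((U U\<^sup>*)\<inverse>)\<close> to the dynamics: it measures the initial points in the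
  coordinates that diagonalize \<open>A\<close>.\<close>

lemma mu_form_eq_norm:
  assumes "invertible U"
  shows "Re (\<Sum>i\<in>UNIV. cvec x $ i * (matrix_inv (U ** conj_transpose U) *v cvec x) $ i)
    = (norm (matrix_inv U *v cvec x))\<^sup>2"
proof -
  have "Re (\<Sum>i\<in>UNIV. cvec x $ i * w $ i) = cvec x \<bullet> w" for w
    by (simp add: inner_vec_def inner_complex_def cvec_def)
  moreover have "cvec x \<bullet> (matrix_inv (U ** conj_transpose U) *v cvec x)
      = (norm (matrix_inv U *v cvec x))\<^sup>2"
    unfolding matrix_inv_mult_conj_transpose[OF assms] matrix_vector_mul_assoc[symmetric]
    by (metis inner_commute inner_conj_transpose_left dot_square_norm)
  ultimately show ?thesis by simp
qed

lemma
  assumes "compact X" and U: "invertible U"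
  shows norm_le_mu: "x \<in> X \<Longrightarrow>
      (norm (matrix_inv U *v cvec x))\<^sup>2 \<le> mu X (matrix_inv (U ** conj_transpose U))"
    and mu_pos: "x \<in> X \<Longrightarrow> x \<noteq> 0 \<Longrightarrow> 0 < mu X (matrix_inv (U ** conj_transpose U))"
proof -
  let ?g = "\<lambda>x. (norm (matrix_inv U *v cvec x))\<^sup>2"
  have mu: "mu X (matrix_inv (U ** conj_transpose U)) = (SUP x\<in>X. ?g x)"
    unfolding mu_def mu_form_eq_norm[OF U] ..
  have "bounded_linear (\<lambda>x. matrix_inv U *v cvec x)"
    by (rule bounded_linear_compose[OF matrix_vector_mul_bounded_linear bounded_linear_cvec])
  then have "continuous_on X ?g"
    by (intro continuous_intros linear_continuous_on)
  then have "compact (?g ` X)" using \<open>compact X\<close> by (rule compact_continuous_image)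
  then have bdd: "bdd_above (?g ` X)" by (intro bounded_imp_bdd_above compact_imp_bounded)
  show le: "?g x \<le> mu X (matrix_inv (U ** conj_transpose U))" if "x \<in> X" for x
    unfolding mu using that bdd by (intro cSUP_upper)
  show "0 < mu X (matrix_inv (U ** conj_transpose U))" if "x \<in> X" "x \<noteq> 0" for x
  proof -
    have "matrix_inv U *v cvec x \<noteq> 0"
      using U that(2) by (metis cvec_eq_0_iff matrix_inv_cancel(2) matrix_vector_mult_0_right)
    then have "0 < ?g x" by simp
    then show ?thesis using le[OF that(1)] by (rule less_le_trans)
  qed
qed

section \<open>Powers of a diagonalizable matrix\<close>

lemma diagonal_mult_nth:
  fixes D :: "complex^'n^'n"
  assumes "diagonal_matrix D"
  shows "(D *v z) $ i = D $ i $ i * z $ i"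
proof -
  have "(D *v z) $ i = (\<Sum>j\<in>UNIV. if j = i then D $ i $ i * z $ i else 0)"
    unfolding matrix_vector_mult_def vec_lambda_beta using assms
    by (intro sum.cong) (auto simp: diagonal_matrix_def)
  then show ?thesis by simp
qed

text \<open>As \<open>spectral_radius\<close> is a \<open>Max\<close>, a single entry of \<open>D\<close> is bounded by it only because the
  eigenvalues of \<open>A\<close> form a finite set, namely the set of all diagonal entries of \<open>D\<close>.\<close>

lemma diagonal_entry_le_spectral_radius:
  fixes A :: "real^'n^'n" and U D :: "complex^'n^'n"
  assumes U: "invertible U" and D: "diagonal_matrix D"
    and A: "cmat A = U ** D ** matrix_inv U"
  shows "cmod (D $ i $ i) \<le> spectral_radius A"
proof -
  have act: "cmat A *v (U *v z) = U *v (D *v z)" for z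
    unfolding A using U by (simp add: matrix_inv_cancel flip: matrix_vector_mul_assoc)
  have "is_eigenvalue (cmat A) (D $ i $ i)" for i
  proof -
    let ?e = "axis i 1 :: complex^'n"
    have e: "D *v ?e = D $ i $ i *s ?e"
      by (simp add: vec_eq_iff diagonal_mult_nth[OF D] axis_def)
    have "cmat A *v (U *v ?e) = D $ i $ i *s (U *v ?e)"
      unfolding act e by (simp add: vector_scalar_commute)
    moreover have "U *v ?e \<noteq> 0"
      using U by (metis matrix_inv_cancel(1) matrix_vector_mult_0_right axis_eq_0_iff zero_neq_one)
    ultimately show ?thesis unfolding is_eigenvalue_def by blast
  qed
  moreover have "c \<in> range (\<lambda>i. D $ i $ i)" if c: "is_eigenvalue (cmat A) c" for c
  proof -
    obtain v where v: "v \<noteq> 0" "cmat A *v v = c *s v" using c by (auto simp: is_eigenvalue_def)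
    define w where "w = matrix_inv U *v v"
    have vw: "v = U *v w" using U by (simp add: w_def matrix_inv_cancel)
    have "U *v (D *v w) = U *v (c *s w)"
      using v(2) by (simp add: vw act vector_scalar_commute)
    then have Dw: "D *v w = c *s w" using U by (metis matrix_inv_cancel(1))
    have "w \<noteq> 0" using v(1) vw by auto
    then obtain i where i: "w $ i \<noteq> 0" by (auto simp: vec_eq_iff)
    have "D $ i $ i * w $ i = c * w $ i"
      using Dw by (simp add: vec_eq_iff diagonal_mult_nth[OF D])
    with i show ?thesis by auto
  qed
  ultimately have "{cmod c | c. is_eigenvalue (cmat A) c} = range (\<lambda>i. cmod (D $ i $ i))"
    by blast
  then show ?thesis unfolding spectral_radius_def by simp
qed

lemma norm_diagonal_mult_le:
  fixes D :: "complex^'n^'n"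
  assumes D: "diagonal_matrix D" and le: "\<And>i. cmod (D $ i $ i) \<le> r"
  shows "norm (D *v z) \<le> r * norm z"
proof -
  have "0 \<le> r" using le norm_ge_zero order_trans by blast
  have "norm (D *v z) \<le> norm (r *\<^sub>R z)"
    by (rule norm_le_componentwise_cart)
      (simp add: diagonal_mult_nth[OF D] norm_mult le mult_right_mono \<open>0 \<le> r\<close>)
  then show ?thesis using \<open>0 \<le> r\<close> by simp
qed

text \<open>One step of the dynamics multiplies \<open>U\<inverse> A\<^sup>k x\<close> by \<open>D\<close>.\<close>

lemma norm_orbit_le:
  fixes A :: "real^'n^'n" and U D :: "complex^'n^'n"
  assumes U: "invertible U" and D: "diagonal_matrix D"
    and A: "cmat A = U ** D ** matrix_inv U"
  shows "norm (matrix_inv U *v cvec (matpow A k *v x))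
    \<le> spectral_radius A ^ k * norm (matrix_inv U *v cvec x)"
proof (induction k)
  case (Suc k)
  let ?z = "matrix_inv U *v cvec (matpow A k *v x)"
  have le: "cmod (D $ i $ i) \<le> spectral_radius A" for i
    using assms by (rule diagonal_entry_le_spectral_radius)
  have "matrix_inv U *v cvec (matpow A (Suc k) *v x) = D *v ?z"
    by (simp add: A matrix_inv_cancel[OF U] flip: matrix_vector_mul_assoc cmat_mult_cvec)
  then have "norm (matrix_inv U *v cvec (matpow A (Suc k) *v x)) \<le> spectral_radius A * norm ?z"
    using norm_diagonal_mult_le[OF D le] by simp
  also have "\<dots> \<le> spectral_radius A * (spectral_radius A ^ k * norm (matrix_inv U *v cvec x))"
    using Suc le norm_ge_zero order_trans by (intro mult_left_mono) blast+
  finally show ?case by (simp add: mult_ac)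
qed simp

lemma spectral_radius_nonneg:
  fixes A :: "real^'n^'n" and U D :: "complex^'n^'n"
  assumes "invertible U" "diagonal_matrix D" "cmat A = U ** D ** matrix_inv U"
  shows "0 \<le> spectral_radius A"
  using diagonal_entry_le_spectral_radius[OF assms] norm_ge_zero order_trans by blast

section \<open>Geometric decay of the values\<close>

text \<open>With \<open>y = U z\<close> the quadratic part is \<open>z\<^sup>* (U\<^sup>* Q U) z\<close> and the linear part is the real inner
  product of \<open>U\<^sup>* q\<close> with \<open>z\<close>. The absolute value around \<open>\<lambda>\<^sub>m\<^sub>a\<^sub>x\<close> keeps the bound monotone in
  \<open>\<parallel>z\<parallel>\<close>, so that an upper bound on \<open>\<parallel>z\<parallel>\<close> can be inserted.\<close>

lemma quadratic_form_le:
  fixes U :: "complex^'n^'n" and y :: "real^'n"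
  assumes U: "invertible U" and Q: "transpose Q = Q"
  defines "z \<equiv> matrix_inv U *v cvec y"
  shows "y \<bullet> (Q *v y) + q \<bullet> y
    \<le> \<bar>lambda_max (conj_transpose U ** cmat Q ** U)\<bar> * (norm z)\<^sup>2
      + norm (conj_transpose U *v cvec q) * norm z"
proof -
  let ?B = "conj_transpose U ** cmat Q ** U"
  have Uz: "cvec y = U *v z" using U by (simp add: z_def matrix_inv_cancel)
  have B: "conj_transpose ?B = ?B"
    using Q by (simp add: conj_transpose_mult matrix_mul_assoc conj_transpose_cmat)
  have "y \<bullet> (Q *v y) = (U *v z) \<bullet> (cmat Q *v (U *v z))"
    by (simp add: cmat_mult_cvec flip: Uz)
  also have "\<dots> = z \<bullet> (?B *v z)"
    by (metis conj_transpose_conj_transpose inner_conj_transpose_left matrix_vector_mul_assoc)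
  also have "\<dots> \<le> lambda_max ?B * (norm z)\<^sup>2" by (rule rayleigh_le_lambda_max[OF B])
  also have "\<dots> \<le> \<bar>lambda_max ?B\<bar> * (norm z)\<^sup>2" by (intro mult_right_mono) auto
  finally have "y \<bullet> (Q *v y) \<le> \<bar>lambda_max ?B\<bar> * (norm z)\<^sup>2" .
  moreover have "q \<bullet> y = (conj_transpose U *v cvec q) \<bullet> z"
    by (simp add: inner_conj_transpose_left flip: Uz)
  ultimately show ?thesis using norm_cauchy_schwarz[of "conj_transpose U *v cvec q" z] by linarith
qed

text \<open>Rewriting the previous bound in terms of
  \<open>t = \<rho>\<^sup>k sqrt (\<Lambda> \<mu>)\<close> absorbs \<open>\<Lambda>\<close> and \<open>\<mu>\<close> and leaves
  \<open>\<parallel>U\<^sup>* q\<parallel> / sqrt \<Lambda>\<close>, that is \<open>2 V_diag\<close>, as the coefficient of the linear term.\<close>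

lemma nu_le:
  fixes A :: "real^'n^'n" and U D :: "complex^'n^'n" and k :: nat
  assumes X: "compact X" "X \<noteq> {}" and U: "invertible U" and D: "diagonal_matrix D"
    and A: "cmat A = U ** D ** matrix_inv U" and Q: "transpose Q = Q"
    and nz: "lambda_max (conj_transpose U ** cmat Q ** U) \<noteq> 0"
  defines "t \<equiv> spectral_radius A ^ k * sqrt (\<bar>lambda_max (conj_transpose U ** cmat Q ** U)\<bar>
                               * mu X (matrix_inv (U ** conj_transpose U)))"
  shows "nu X A Q q k \<le> t\<^sup>2 + 2 * V_diag Q q U * t"
proof -
  define L where "L = \<bar>lambda_max (conj_transpose U ** cmat Q ** U)\<bar>"
  define m where "m = mu X (matrix_inv (U ** conj_transpose U))"
  define b where "b = norm (conj_transpose U *v cvec q)"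
  define \<rho> where "\<rho> = spectral_radius A"
  have L: "L > 0" using nz by (simp add: L_def)
  have \<rho>: "0 \<le> \<rho>" unfolding \<rho>_def by (rule spectral_radius_nonneg[OF U D A])
  have t: "t = \<rho> ^ k * sqrt (L * m)" by (simp add: t_def L_def m_def \<rho>_def)
  have V: "V_diag Q q U = b / (2 * sqrt L)" by (simp add: V_diag_def L_def b_def)
  show ?thesis unfolding nu_def
  proof (rule cSUP_least[OF X(2)])
    fix x assume x: "x \<in> X"
    define y where "y = matpow A k *v x"
    define z where "z = matrix_inv U *v cvec y"
    have n0: "(norm (matrix_inv U *v cvec x))\<^sup>2 \<le> m"
      unfolding m_def by (rule norm_le_mu[OF X(1) U x])
    then have m: "0 \<le> m" by (rule order_trans[OF zero_le_power2])
    have "norm z \<le> \<rho> ^ k * norm (matrix_inv U *v cvec x)"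
      unfolding z_def y_def \<rho>_def by (rule norm_orbit_le[OF U D A])
    also have "\<dots> \<le> \<rho> ^ k * sqrt m"
      using \<rho> n0 by (intro mult_left_mono real_le_rsqrt) auto
    finally have z: "norm z \<le> \<rho> ^ k * sqrt m" .
    have "x \<bullet> ((transpose (matpow A k) ** Q ** matpow A k) *v x) = y \<bullet> (Q *v y)"
      unfolding y_def
      by (metis dot_lmul_matrix matrix_vector_mul_assoc vector_transpose_matrix)
    then have "x \<bullet> ((transpose (matpow A k) ** Q ** matpow A k) *v x) + q \<bullet> (matpow A k *v x)
        \<le> L * (norm z)\<^sup>2 + b * norm z"
      using quadratic_form_le[OF U Q, of y q] by (simp add: L_def b_def z_def y_def)
    also have "\<dots> \<le> L * (\<rho> ^ k * sqrt m)\<^sup>2 + b * (\<rho> ^ k * sqrt m)"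
      using z L by (intro add_mono mult_left_mono power_mono) (auto simp: b_def)
    also have "\<dots> = t\<^sup>2 + 2 * V_diag Q q U * t"
      using L m unfolding t V by (simp add: real_sqrt_mult power_mult_distrib)
    finally show "x \<bullet> ((transpose (matpow A k) ** Q ** matpow A k) *v x) + q \<bullet> (matpow A k *v x)
        \<le> t\<^sup>2 + 2 * V_diag Q q U * t" .
  qed
qed

section \<open>Prefix suprema and the root of the bound\<close>

text \<open>An index \<open>j \<le> n\<close> whose value dominates everything after \<open>n\<close> makes \<open>n\<close> itself a member of the
  set whose infimum is \<open>K_geq \<nu>\<close>.\<close>

lemma K_geq_le:
  assumes "j \<le> n" and "\<And>k. n < k \<Longrightarrow> \<nu> k \<le> \<nu> j"
  shows "K_geq \<nu> \<le> ereal (real n)"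
proof -
  have "sup_from \<nu> (n + 1) \<le> \<nu> j"
    unfolding sup_from_def using assms(2) by (intro cSUP_least) auto
  also have "\<nu> j \<le> sup_between \<nu> 0 n"
    unfolding sup_between_def using assms(1) by (intro cSUP_upper) auto
  finally show ?thesis unfolding K_geq_def by (intro INF_lower) simp
qed

text \<open>\<open>t\<^sup>2 + 2 V t = (t + V)\<^sup>2 - V\<^sup>2\<close>.\<close>

lemma quadratic_less_of_less_root:
  fixes t V c :: real
  assumes "0 \<le> t" "0 \<le> V" "t < sqrt (c + V\<^sup>2) - V"
  shows "t\<^sup>2 + 2 * V * t < c"
proof -
  have "t + V < sqrt (c + V\<^sup>2)" using assms by simp
  moreover have "0 \<le> t + V" using assms by simp
  ultimately have "(t + V)\<^sup>2 < c + V\<^sup>2"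
    using real_sqrt_less_iff[of "(t + V)\<^sup>2" "c + V\<^sup>2"] by simp
  then show ?thesis by (simp add: power2_eq_square algebra_simps)
qed

lemma root_pos:
  fixes V c :: real
  assumes "0 < c"
  shows "0 < sqrt (c + V\<^sup>2) - V"
  using real_less_rsqrt[of V "c + V\<^sup>2"] assms by simp

lemma power_less_of_log_less:
  fixes r s :: real
  assumes "0 < r" "r < 1" "0 < s" "ln s / ln r < real k"
  shows "r ^ k < s"
proof -
  have "real k * ln r < ln s" using assms by (simp add: divide_less_eq ln_less_zero)
  then have "ln (r ^ k) < ln s" using assms by (simp add: ln_realpow)
  then show ?thesis using assms by simp
qed

theorem proposition7:
  fixes X :: "(real^'n) set" and A Q :: "real^'n^'n" and q :: "real^'n"
    and U D :: "complex^'n^'n"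
  assumes "polytope X" and "X \<noteq> {}" and "X \<noteq> {0}"
    and "spectral_radius A < 1"
    and "invertible U" and "diagonal_matrix D" and "cmat A = U ** D ** matrix_inv U"
    and "transpose Q = Q" and "lambda_max (cmat Q) \<noteq> 0"
  shows
    "(\<forall>j \<in> Pos (nu X A Q q). \<forall>k \<in> Pos (nu X A Q q).
        nu X A Q q k \<le> nu X A Q q j \<longrightarrow> K_diag X A Q q U j \<le> K_diag X A Q q U k) \<and>
     (\<forall>j \<in> Pos (nu X A Q q).
        (j \<notin> Argmax (nu X A Q q) \<longrightarrow>
           K_geq (nu X A Q q) \<le> ereal (real_of_int (K_diag X A Q q U j))) \<and>
        (j \<in> Argmax (nu X A Q q) \<longrightarrow>
           K_geq (nu X A Q q)
             \<le> max (ereal (real j)) (ereal (real_of_int (K_diag X A Q q U j)))))"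
proof -
  define \<nu> where "\<nu> = nu X A Q q"
  define K where "K = K_diag X A Q q U"
  define V where "V = V_diag Q q U"
  define \<rho> where "\<rho> = spectral_radius A"
  define S where "S = sqrt (\<bar>lambda_max (conj_transpose U ** cmat Q ** U)\<bar>
                               * mu X (matrix_inv (U ** conj_transpose U)))"
  define h where "h c = sqrt (c + V\<^sup>2) - V" for c
  have K: "K j = (if \<rho> = 0 then 1 else \<lfloor>ln (h (\<nu> j) * inverse S) / ln \<rho>\<rfloor> + 1)" for j
    unfolding K_def K_diag_def \<rho>_def h_def \<nu>_def V_def S_def ..
  have compact: "compact X" using assms(1) by (rule polytope_imp_compact)
  have H: "conj_transpose (cmat Q) = cmat Q" by (simp add: conj_transpose_cmat assms(8))
  have nz: "lambda_max (conj_transpose U ** cmat Q ** U) \<noteq> 0"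
    by (rule lambda_max_congruence_nonzero[OF H assms(5,9)])
  obtain x where "x \<in> X" "x \<noteq> 0" using assms(2,3) by auto
  then have S: "0 < S" using mu_pos[OF compact assms(5)] nz by (simp add: S_def)
  have \<rho>: "0 \<le> \<rho>" "\<rho> < 1" using spectral_radius_nonneg[OF assms(5-7)] assms(4) by (auto simp: \<rho>_def)
  have V: "0 \<le> V" by (simp add: V_def V_diag_def)
  have bound: "\<nu> k \<le> (\<rho> ^ k * S)\<^sup>2 + 2 * V * (\<rho> ^ k * S)" for k
    unfolding \<nu>_def V_def \<rho>_def S_def by (rule nu_le[OF compact assms(2,5-8) nz])
  have h_pos: "0 < h (\<nu> j)" if "j \<in> Pos \<nu>" for j
    using that unfolding h_def by (intro root_pos) (simp add: Pos_def)
  \<comment> \<open>For \<open>\<rho> = 0\<close> the index is \<open>1\<close>, and \<open>0\<^sup>k = 0\<close> for \<open>k \<ge> 1\<close>, so the degenerate case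
    joins the general one as soon as \<open>\<rho>\<^sup>k\<close> is compared with \<open>h (\<nu> j) / S\<close>.\<close>
  have less: "\<nu> k < \<nu> j" if j: "j \<in> Pos \<nu>" and k: "K j \<le> int k" for j k
  proof -
    have "\<rho> ^ k < h (\<nu> j) * inverse S"
    proof (cases "\<rho> = 0")
      case True
      then show ?thesis using k h_pos[OF j] S by (simp add: K zero_power)
    next
      case False
      then have "ln (h (\<nu> j) * inverse S) / ln \<rho> < real k" using k unfolding K by simp linarith
      then show ?thesis
        using \<rho> False S h_pos[OF j] by (intro power_less_of_log_less) auto
    qed
    then have "\<rho> ^ k * S < h (\<nu> j)" using S by (simp add: field_simps)
    then have "(\<rho> ^ k * S)\<^sup>2 + 2 * V * (\<rho> ^ k * S) < \<nu> j"
      using V \<rho> S unfolding h_def by (intro quadratic_less_of_less_root) auto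
    with bound[of k] show ?thesis by linarith
  qed
  have mono: "K j \<le> K k" if jk: "j \<in> Pos \<nu>" "k \<in> Pos \<nu>" "\<nu> k \<le> \<nu> j" for j k
  proof (cases "\<rho> = 0")
    case False
    have "h (\<nu> k) \<le> h (\<nu> j)" using jk by (simp add: h_def)
    then have "ln (h (\<nu> k) * inverse S) \<le> ln (h (\<nu> j) * inverse S)"
      using h_pos jk S by (subst ln_le_cancel_iff) auto
    then have "ln (h (\<nu> j) * inverse S) / ln \<rho> \<le> ln (h (\<nu> k) * inverse S) / ln \<rho>"
      using \<rho> False by (intro divide_right_mono_neg) auto
    then show ?thesis using False by (simp add: K floor_mono)
  qed (simp add: K)
  have K_bound: "K_geq \<nu> \<le> ereal (real_of_int (K j))" if j: "j \<in> Pos \<nu>" for j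
  proof -
    \<comment> \<open>Otherwise \<open>less\<close> at \<open>k = j\<close> would give \<open>\<nu> j < \<nu> j\<close>.\<close>
    have jK: "int j < K j" using less[OF j, of j] by linarith
    have "K_geq \<nu> \<le> ereal (real (nat (K j)))"
      using less[OF j] jK by (intro K_geq_le[of j]) (auto intro!: less_imp_le)
    then show ?thesis using jK by simp
  qed
  show ?thesis
    unfolding \<nu>_def[symmetric] K_def[symmetric] using mono K_bound by (simp add: le_max_iff_disj)
qed

end
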